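(* The hierarchy $(\mathrm{FO}_q)_{q\in\mathbb N}$ is strict on arithmetical structures: there is a finite relational vocabulary $\tau\supseteq\{<,+,\times\}$ such that for every $q\in\mathbb N$ there is a first-order $\tau$-sentence of quantifier rank at most $q+1$ which is not equivalent, on the class of all finite $\tau$-structures with built-in addition and multiplication, to any first-order $\tau$-sentence of quantifier rank at most $q$.
   Context: For $n\in\mathbb N$ let $[n]=\{0,\dots,n-1\}$ with natural order $<^{[n]}$, $+^{[n]}=\{(a,b,c)\in[n]^3:c=a+b\}$, $\times^{[n]}=\{(a,b,c)\in[n]^3:c=ab\}$. A finite $\tau$-structure ($<$ binary, $+,\times$ ternary) has built-in addition and multiplication if its $\{<,+,\times\}$-reduct is isomorphic to $([n],<^{[n]},+^{[n]},\times^{[n]})$ with $n$ its size. $\mathrm{FO}_q$ denotes first-order sentences of quantifier rank at most $q$. *)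

theory Defs
  imports Main
begin

text \<open>
  Relation symbols: the three arithmetical symbols (order, addition, multiplication) and a supply
  of further symbols \<open>Other i k\<close> with name \<open>i\<close> and arity \<open>k\<close>. A finite relational vocabulary
  is a finite set of symbols.
\<close>

datatype rel_sym = Lt | Add | Mul | Other nat nat

fun arity :: "rel_sym \<Rightarrow> nat" where
  "arity Lt = 2"
| "arity Add = 3"
| "arity Mul = 3"
| "arity (Other i k) = k"

definition arith_vocab :: "rel_sym set" where
  "arith_vocab = {Lt, Add, Mul}"

record 'a struct =
  univ :: "'a set"
  interp :: "rel_sym \<Rightarrow> 'a list set"

text \<open>
  The interpretation of symbols outside the vocabulary is irrelevant and left unconstrained.
\<close>

definition fin_structure :: "rel_sym set \<Rightarrow> 'a struct \<Rightarrow> bool" where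
  "fin_structure \<tau> M \<longleftrightarrow>
     finite (univ M) \<and> univ M \<noteq> {} \<and>
     (\<forall>R\<in>\<tau>. \<forall>as\<in>interp M R. length as = arity R \<and> set as \<subseteq> univ M)"

text \<open>
  Isomorphism of the \<open>\<sigma>\<close>-reducts of two structures.
\<close>

definition isomorphic_on :: "rel_sym set \<Rightarrow> 'a struct \<Rightarrow> 'b struct \<Rightarrow> bool" where
  "isomorphic_on \<sigma> M N \<longleftrightarrow>
     (\<exists>f. bij_betw f (univ M) (univ N) \<and>
        (\<forall>R\<in>\<sigma>. \<forall>as. length as = arity R \<and> set as \<subseteq> univ M \<longrightarrow>
           (as \<in> interp M R \<longleftrightarrow> map f as \<in> interp N R)))"

fun arith_interp :: "nat \<Rightarrow> rel_sym \<Rightarrow> nat list set" where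
  "arith_interp n Lt = {[a, b] | a b. a < n \<and> b < n \<and> a < b}"
| "arith_interp n Add = {[a, b, c] | a b c. a < n \<and> b < n \<and> c < n \<and> c = a + b}"
| "arith_interp n Mul = {[a, b, c] | a b c. a < n \<and> b < n \<and> c < n \<and> c = a * b}"
| "arith_interp n (Other i k) = {}"

definition arith_structure :: "nat \<Rightarrow> nat struct" where
  "arith_structure n = \<lparr>univ = {..<n}, interp = arith_interp n\<rparr>"

definition built_in_arith :: "'a struct \<Rightarrow> bool" where
  "built_in_arith M \<longleftrightarrow> isomorphic_on arith_vocab M (arith_structure (card (univ M)))"

definition arith_structures :: "rel_sym set \<Rightarrow> 'a struct set" where
  "arith_structures \<tau> = {M. fin_structure \<tau> M \<and> built_in_arith M}"

datatype fm =
    Fls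
  | Eq nat nat
  | Rel rel_sym "nat list"
  | Neg fm
  | Conj fm fm
  | Disj fm fm
  | Ex nat fm
  | All nat fm

fun sat :: "'a struct \<Rightarrow> (nat \<Rightarrow> 'a) \<Rightarrow> fm \<Rightarrow> bool" where
  "sat M s Fls \<longleftrightarrow> False"
| "sat M s (Eq x y) \<longleftrightarrow> s x = s y"
| "sat M s (Rel R xs) \<longleftrightarrow> map s xs \<in> interp M R"
| "sat M s (Neg \<phi>) \<longleftrightarrow> \<not> sat M s \<phi>"
| "sat M s (Conj \<phi> \<psi>) \<longleftrightarrow> sat M s \<phi> \<and> sat M s \<psi>"
| "sat M s (Disj \<phi> \<psi>) \<longleftrightarrow> sat M s \<phi> \<or> sat M s \<psi>"
| "sat M s (Ex x \<phi>) \<longleftrightarrow> (\<exists>a\<in>univ M. sat M (s(x := a)) \<phi>)"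
| "sat M s (All x \<phi>) \<longleftrightarrow> (\<forall>a\<in>univ M. sat M (s(x := a)) \<phi>)"

fun over_vocab :: "rel_sym set \<Rightarrow> fm \<Rightarrow> bool" where
  "over_vocab \<tau> Fls \<longleftrightarrow> True"
| "over_vocab \<tau> (Eq x y) \<longleftrightarrow> True"
| "over_vocab \<tau> (Rel R xs) \<longleftrightarrow> R \<in> \<tau> \<and> length xs = arity R"
| "over_vocab \<tau> (Neg \<phi>) \<longleftrightarrow> over_vocab \<tau> \<phi>"
| "over_vocab \<tau> (Conj \<phi> \<psi>) \<longleftrightarrow> over_vocab \<tau> \<phi> \<and> over_vocab \<tau> \<psi>"
| "over_vocab \<tau> (Disj \<phi> \<psi>) \<longleftrightarrow> over_vocab \<tau> \<phi> \<and> over_vocab \<tau> \<psi>"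
| "over_vocab \<tau> (Ex x \<phi>) \<longleftrightarrow> over_vocab \<tau> \<phi>"
| "over_vocab \<tau> (All x \<phi>) \<longleftrightarrow> over_vocab \<tau> \<phi>"

fun free_vars :: "fm \<Rightarrow> nat set" where
  "free_vars Fls = {}"
| "free_vars (Eq x y) = {x, y}"
| "free_vars (Rel R xs) = set xs"
| "free_vars (Neg \<phi>) = free_vars \<phi>"
| "free_vars (Conj \<phi> \<psi>) = free_vars \<phi> \<union> free_vars \<psi>"
| "free_vars (Disj \<phi> \<psi>) = free_vars \<phi> \<union> free_vars \<psi>"
| "free_vars (Ex x \<phi>) = free_vars \<phi> - {x}"
| "free_vars (All x \<phi>) = free_vars \<phi> - {x}"

fun quant_rank :: "fm \<Rightarrow> nat" where
  "quant_rank Fls = 0"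
| "quant_rank (Eq x y) = 0"
| "quant_rank (Rel R xs) = 0"
| "quant_rank (Neg \<phi>) = quant_rank \<phi>"
| "quant_rank (Conj \<phi> \<psi>) = max (quant_rank \<phi>) (quant_rank \<psi>)"
| "quant_rank (Disj \<phi> \<psi>) = max (quant_rank \<phi>) (quant_rank \<psi>)"
| "quant_rank (Ex x \<phi>) = Suc (quant_rank \<phi>)"
| "quant_rank (All x \<phi>) = Suc (quant_rank \<phi>)"

definition FO :: "rel_sym set \<Rightarrow> nat \<Rightarrow> fm set" where
  "FO \<tau> q = {\<phi>. over_vocab \<tau> \<phi> \<and> free_vars \<phi> = {} \<and> quant_rank \<phi> \<le> q}"

definition models :: "'a struct \<Rightarrow> fm \<Rightarrow> bool" where
  "models M \<phi> \<longleftrightarrow> (\<forall>s. range s \<subseteq> univ M \<longrightarrow> sat M s \<phi>)"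

definition equivalent_on :: "'a struct set \<Rightarrow> fm \<Rightarrow> fm \<Rightarrow> bool" where
  "equivalent_on K \<phi> \<psi> \<longleftrightarrow> (\<forall>M\<in>K. models M \<phi> \<longleftrightarrow> models M \<psi>)"

end

theory Submission
  imports Defs "HOL-Library.Nat_Bijection"
begin

text \<open>
  The proof is a counting argument. The number of rank-\<open>q\<close> types of structures is at most a
  \<open>(q + 1)\<close>-fold exponential of \<open>A\<close>, where \<open>A\<close> is the number of atoms in \<open>q\<close> variables,
  a polynomial in \<open>q\<close>. On the other hand, add to arithmetic relations that describe hereditarily
  finite sets of height \<open>q + 1\<close> over \<open>2 ^ (3 * (q + 1))\<close> urelements, where the urelement reached at
  the end of a path \<open>x\<^sub>q \<ni> \<dots> \<ni> x\<^sub>0\<close> is recognised by the three bits that each \<open>x\<^sub>i\<close> contributes.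
  Sentences of rank \<open>q + 1\<close> tell all these sets apart, and their number is a \<open>(q + 1)\<close>-fold
  exponential of \<open>8 ^ (q + 1) > A\<close>. Hence two of the structures agree on rank \<open>q\<close> and
  differ on rank \<open>q + 1\<close>.
\<close>

section \<open>Iterated exponentials and Ackermann codes\<close>

primrec tower :: "nat \<Rightarrow> nat \<Rightarrow> nat" where
  "tower 0 a = a"
| "tower (Suc k) a = 2 ^ tower k a"

lemma tower_Suc_right: "tower (Suc k) a = tower k (2 ^ a)"
  by (induction k) auto

lemma strict_mono_tower: "strict_mono (tower k)"
  by (induction k) (auto simp: strict_mono_def)

lemma mono_tower_height: "mono (\<lambda>k. tower k a)"
  by (simp add: mono_iff_le_Suc less_imp_le)

lemma less_two_power_iff_set_decode: "t < 2 ^ n \<longleftrightarrow> set_decode t \<subseteq> {..<n}"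
proof
  assume "t < 2 ^ n"
  then have "t div 2 ^ b = 0" if "n \<le> b" for b
    using that by (meson div_less order_less_le_trans one_le_numeral power_increasing)
  then have "b \<notin> set_decode t" if "n \<le> b" for b
    using that by (simp add: set_decode_def)
  then show "set_decode t \<subseteq> {..<n}"
    by (meson lessThan_iff not_le subsetI)
next
  assume "set_decode t \<subseteq> {..<n}"
  then have "set_encode (set_decode t) \<le> (\<Sum>b<n. 2 ^ b)"
    unfolding set_encode_def by (intro sum_mono2) auto
  also have "\<dots> < 2 ^ n"
    by (induction n) auto
  finally show "t < 2 ^ n" by simp
qed

lemma set_encode_less_two_power:
  assumes "A \<subseteq> {..<n}"
  shows "set_encode A < 2 ^ n"
  using assms finite_subset[OF assms] by (simp add: less_two_power_iff_set_decode)

lemma eq_iff_set_decode_lessThan: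
  assumes "s < 2 ^ n" "t < 2 ^ n"
  shows "s = t \<longleftrightarrow> (\<forall>b<n. b \<in> set_decode s \<longleftrightarrow> b \<in> set_decode t)"
proof -
  have "s = t \<longleftrightarrow> set_decode s = set_decode t"
    by (metis set_decode_inverse)
  then show ?thesis
    using assms unfolding less_two_power_iff_set_decode by blast
qed

section \<open>Back-and-forth for first-order formulas\<close>

lemma sat_cong:
  assumes "\<And>x. x \<in> free_vars \<phi> \<Longrightarrow> s x = s' x"
  shows "sat M s \<phi> \<longleftrightarrow> sat M s' \<phi>"
  using assms
proof (induction \<phi> arbitrary: s s')
  case (Rel R xs)
  then have "map s xs = map s' xs" by simp
  then show ?case by (simp del: map_eq_conv)
next
  case (Neg \<phi>)
  then show ?case by (metis free_vars.simps(4) sat.simps(4))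
next
  case (Conj \<phi> \<psi>)
  then show ?case by (metis UnCI free_vars.simps(5) sat.simps(5))
next
  case (Disj \<phi> \<psi>)
  then show ?case by (metis UnCI free_vars.simps(6) sat.simps(6))
next
  case (Ex x \<phi>)
  have "sat M (s(x := a)) \<phi> \<longleftrightarrow> sat M (s'(x := a)) \<phi>" for a
    by (rule Ex.IH) (use Ex.prems in auto)
  then show ?case by simp
next
  case (All x \<phi>)
  have "sat M (s(x := a)) \<phi> \<longleftrightarrow> sat M (s'(x := a)) \<phi>" for a
    by (rule All.IH) (use All.prems in auto)
  then show ?case by simp
qed simp_all

lemma models_iff_sat:
  assumes "free_vars \<phi> = {}" "univ M \<noteq> {}"
  shows "models M \<phi> \<longleftrightarrow> sat M s \<phi>"
proof -
  obtain a where "range (\<lambda>_::nat. a) \<subseteq> univ M"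
    using assms(2) by blast
  moreover have "sat M s' \<phi> \<longleftrightarrow> sat M s \<phi>" for s'
    by (rule sat_cong) (simp add: assms(1))
  ultimately show ?thesis
    unfolding models_def by blast
qed

text \<open>
  A tuple interprets a formula through a map \<open>v\<close> from variables to positions; this is what
  allows formulas to reuse variables.
\<close>

lemma sat_nth_append_upd:
  assumes "v ` (free_vars \<phi> - {x}) \<subseteq> {..<length as}"
  shows "sat M ((!) (as @ [a]) \<circ> v(x := length as)) \<phi> \<longleftrightarrow> sat M (((!) as \<circ> v)(x := a)) \<phi>"
  by (rule sat_cong) (use assms in \<open>auto simp: nth_append\<close>)

lemma sat_quantifier_back_and_forth:
  assumes "rel_set E (univ M) (univ N)"
    and "\<And>a b. E a b \<Longrightarrow> sat M ((!) (as @ [a]) \<circ> v(x := length as)) \<phi> \<longleftrightarrow>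
      sat N ((!) (bs @ [b]) \<circ> v(x := length as)) \<phi>"
    and "length bs = length as" "v ` (free_vars \<phi> - {x}) \<subseteq> {..<length as}"
  shows "sat M ((!) as \<circ> v) (Ex x \<phi>) \<longleftrightarrow> sat N ((!) bs \<circ> v) (Ex x \<phi>)"
    and "sat M ((!) as \<circ> v) (All x \<phi>) \<longleftrightarrow> sat N ((!) bs \<circ> v) (All x \<phi>)"
proof -
  have "sat M (((!) as \<circ> v)(x := a)) \<phi> \<longleftrightarrow> sat N (((!) bs \<circ> v)(x := b)) \<phi>" if "E a b" for a b
    using assms(2)[OF that] assms(3,4)
      sat_nth_append_upd[of v \<phi> x as M a] sat_nth_append_upd[of v \<phi> x bs N b] by simp
  then have upd_iff: "rel_fun E (=)
      (\<lambda>a. sat M (((!) as \<circ> v)(x := a)) \<phi>) (\<lambda>b. sat N (((!) bs \<circ> v)(x := b)) \<phi>)"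
    by (rule rel_funI)
  show "sat M ((!) as \<circ> v) (Ex x \<phi>) \<longleftrightarrow> sat N ((!) bs \<circ> v) (Ex x \<phi>)"
    unfolding sat.simps by (rule Bex_transfer[THEN rel_funD, THEN rel_funD, OF assms(1) upd_iff])
  show "sat M ((!) as \<circ> v) (All x \<phi>) \<longleftrightarrow> sat N ((!) bs \<circ> v) (All x \<phi>)"
    unfolding sat.simps by (rule Ball_transfer[THEN rel_funD, THEN rel_funD, OF assms(1) upd_iff])
qed

section \<open>Rank types\<close>

definition atoms :: "rel_sym set \<Rightarrow> nat \<Rightarrow> fm set" where
  "atoms \<tau> k = case_prod Eq ` ({..<k} \<times> {..<k}) \<union>
     case_prod Rel ` (SIGMA R:\<tau>. {xs. set xs \<subseteq> {..<k} \<and> length xs = arity R})"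

lemma finite_atoms: "finite \<tau> \<Longrightarrow> finite (atoms \<tau> k)"
  by (auto simp: atoms_def finite_lists_length_eq)

lemma card_atoms_le:
  assumes "finite \<tau>"
  shows "card (atoms \<tau> k) \<le> k\<^sup>2 + (\<Sum>R\<in>\<tau>. k ^ arity R)"
proof -
  let ?E = "{..<k} \<times> {..<k}"
  let ?S = "SIGMA R:\<tau>. {xs. set xs \<subseteq> {..<k} \<and> length xs = arity R}"
  have "finite ?S"
    using assms by (auto simp: finite_lists_length_eq)
  then have "card (atoms \<tau> k) \<le> card ?E + card ?S"
    unfolding atoms_def by (intro order_trans[OF card_Un_le] add_mono card_image_le) auto
  also have "\<dots> = k\<^sup>2 + (\<Sum>R\<in>\<tau>. k ^ arity R)"
    using assms by (simp add: card_lists_length_eq finite_lists_length_eq power2_eq_square)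
  finally show ?thesis .
qed

text \<open>
  Types are hereditarily finite sets, stored as their Ackermann codes.
\<close>

primrec rank_type :: "fm list \<Rightarrow> 'a struct \<Rightarrow> nat \<Rightarrow> 'a list \<Rightarrow> nat" where
  "rank_type \<alpha>s M 0 as = set_encode {i. i < length \<alpha>s \<and> sat M ((!) as) (\<alpha>s ! i)}"
| "rank_type \<alpha>s M (Suc j) as = set_encode ((\<lambda>a. rank_type \<alpha>s M j (as @ [a])) ` univ M)"

lemma rank_type_less: "rank_type \<alpha>s M j as < tower (Suc j) (length \<alpha>s)"
proof (induction j arbitrary: as)
  case 0
  show ?case by (auto intro!: set_encode_less_two_power)
next
  case (Suc j)
  then have "(\<lambda>a. rank_type \<alpha>s M j (as @ [a])) ` univ M \<subseteq> {..<tower (Suc j) (length \<alpha>s)}"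
    by blast
  from set_encode_less_two_power[OF this] show ?case by simp
qed

lemma image_eq_image_iff_rel_set: "f ` A = g ` B \<longleftrightarrow> rel_set (\<lambda>a b. f a = g b) A B"
  unfolding rel_set_def set_eq_subset image_subset_iff image_iff by metis

lemma rank_type_Suc_eq_iff_rel_set:
  assumes "finite (univ M)" "finite (univ N)"
  shows "rank_type \<alpha>s M (Suc j) as = rank_type \<alpha>s N (Suc j) bs \<longleftrightarrow>
    rel_set (\<lambda>a b. rank_type \<alpha>s M j (as @ [a]) = rank_type \<alpha>s N j (bs @ [b])) (univ M) (univ N)"
  using assms by (simp add: set_encode_eq image_eq_image_iff_rel_set)

lemma rank_type_eq_imp_sat_listed_iff:
  assumes "finite (univ M)" "finite (univ N)" "univ M \<noteq> {}"
    and "\<alpha> \<in> set \<alpha>s"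
    and "rank_type \<alpha>s M j as = rank_type \<alpha>s N j bs" "length bs = length as"
    and "free_vars \<alpha> \<subseteq> {..<length as}"
  shows "sat M ((!) as) \<alpha> \<longleftrightarrow> sat N ((!) bs) \<alpha>"
  using assms(5-)
proof (induction j arbitrary: as bs)
  case 0
  obtain i where "i < length \<alpha>s" "\<alpha> = \<alpha>s ! i"
    using assms(4) by (metis in_set_conv_nth)
  moreover have "{i. i < length \<alpha>s \<and> sat M ((!) as) (\<alpha>s ! i)} =
      {i. i < length \<alpha>s \<and> sat N ((!) bs) (\<alpha>s ! i)}"
    using "0.prems"(1) by (simp add: set_encode_eq)
  ultimately show ?case by blast
next
  case (Suc j)
  obtain a b where "rank_type \<alpha>s M j (as @ [a]) = rank_type \<alpha>s N j (bs @ [b])"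
    using Suc.prems(1) assms(3) unfolding rank_type_Suc_eq_iff_rel_set[OF assms(1,2)]
    by (blast dest: rel_setD1)
  then have "sat M ((!) (as @ [a])) \<alpha> \<longleftrightarrow> sat N ((!) (bs @ [b])) \<alpha>"
    by (rule Suc.IH) (use Suc.prems in auto)
  moreover have "sat M ((!) (as @ [a])) \<alpha> \<longleftrightarrow> sat M ((!) as) \<alpha>"
    by (rule sat_cong) (use Suc.prems in \<open>auto simp: nth_append\<close>)
  moreover have "sat N ((!) (bs @ [b])) \<alpha> \<longleftrightarrow> sat N ((!) bs) \<alpha>"
    by (rule sat_cong) (use Suc.prems in \<open>auto simp: nth_append\<close>)
  ultimately show ?case by blast
qed

lemma rank_type_eq_imp_sat_iff:
  assumes "finite (univ M)" "finite (univ N)" "univ M \<noteq> {}"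
    and "atoms \<tau> q \<subseteq> set \<alpha>s"
    and "rank_type \<alpha>s M j as = rank_type \<alpha>s N j bs"
    and "length bs = length as" "length as + j \<le> q"
    and "over_vocab \<tau> \<phi>" "quant_rank \<phi> \<le> j" "v ` free_vars \<phi> \<subseteq> {..<length as}"
  shows "sat M ((!) as \<circ> v) \<phi> \<longleftrightarrow> sat N ((!) bs \<circ> v) \<phi>"
  using assms(5-)
proof (induction \<phi> arbitrary: j as bs v)
  case (Eq x y)
  have "Eq (v x) (v y) \<in> set \<alpha>s"
    using Eq.prems by (intro subsetD[OF assms(4)]) (auto simp: atoms_def)
  from rank_type_eq_imp_sat_listed_iff[OF assms(1-3) this Eq.prems(1,2)] show ?case
    using Eq.prems by simp
next
  case (Rel R xs)
  have "Rel R (map v xs) \<in> set \<alpha>s"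
    using Rel.prems by (intro subsetD[OF assms(4)]) (force simp: atoms_def)
  from rank_type_eq_imp_sat_listed_iff[OF assms(1-3) this Rel.prems(1,2)] show ?case
    using Rel.prems by (simp add: comp_def)
next
  case (Neg \<phi>)
  from Neg.IH[OF Neg.prems(1-3)] Neg.prems(4-) show ?case by simp
next
  case (Conj \<phi> \<psi>)
  from Conj.IH[OF Conj.prems(1-3), of v] Conj.prems(4-) show ?case by (simp add: image_Un)
next
  case (Disj \<phi> \<psi>)
  from Disj.IH[OF Disj.prems(1-3), of v] Disj.prems(4-) show ?case by (simp add: image_Un)
next
  case (Ex x \<phi>)
  then obtain i where j_eq: "j = Suc i" by (cases j) auto
  show ?case
    by (rule sat_quantifier_back_and_forth(1)
        [OF Ex.prems(1)[unfolded j_eq rank_type_Suc_eq_iff_rel_set[OF assms(1,2)]] Ex.IH])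
      (use Ex.prems j_eq in \<open>auto simp: image_subset_iff less_Suc_eq\<close>)
next
  case (All x \<phi>)
  then obtain i where j_eq: "j = Suc i" by (cases j) auto
  show ?case
    by (rule sat_quantifier_back_and_forth(2)
        [OF All.prems(1)[unfolded j_eq rank_type_Suc_eq_iff_rel_set[OF assms(1,2)]] All.IH])
      (use All.prems j_eq in \<open>auto simp: image_subset_iff less_Suc_eq\<close>)
qed simp

lemma FO_indistinguishableE:
  fixes M :: "'i \<Rightarrow> 'a struct"
  assumes "finite \<tau>" "\<And>u. u \<in> U \<Longrightarrow> fin_structure \<tau> (M u)"
    and "tower (Suc q) (card (atoms \<tau> q)) < card U"
  obtains u w where "u \<in> U" "w \<in> U" "u \<noteq> w"
    and "\<And>\<psi>. \<psi> \<in> FO \<tau> q \<Longrightarrow> models (M u) \<psi> \<longleftrightarrow> models (M w) \<psi>"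
proof -
  obtain \<alpha>s where \<alpha>s_enum: "set \<alpha>s = atoms \<tau> q" "distinct \<alpha>s"
    using finite_distinct_list[OF finite_atoms[OF assms(1)]] by blast
  define T where "T u = rank_type \<alpha>s (M u) q []" for u
  have "T ` U \<subseteq> {..<tower (Suc q) (length \<alpha>s)}"
    unfolding T_def using rank_type_less by blast
  then have "card (T ` U) \<le> tower (Suc q) (length \<alpha>s)"
    using card_mono[OF finite_lessThan] by (metis card_lessThan)
  also have "\<dots> < card U"
    using assms(3) \<alpha>s_enum distinct_card[of \<alpha>s] by simp
  finally have "\<not> inj_on T U" by (rule pigeonhole)
  then obtain u w where uw: "u \<in> U" "w \<in> U" "u \<noteq> w" and same_type: "T u = T w"
    unfolding inj_on_def by blast
  then have fin: "fin_structure \<tau> (M u)" "fin_structure \<tau> (M w)"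
    using assms(2) by blast+
  have "models (M u) \<psi> \<longleftrightarrow> models (M w) \<psi>" if "\<psi> \<in> FO \<tau> q" for \<psi>
  proof -
    have "sat (M u) ((!) [] \<circ> id) \<psi> \<longleftrightarrow> sat (M w) ((!) [] \<circ> id) \<psi>"
      by (rule rank_type_eq_imp_sat_iff[where q = q and j = q])
        (use fin that same_type \<alpha>s_enum(1) in \<open>auto simp: fin_structure_def FO_def T_def\<close>)
    then show ?thesis
      using fin that models_iff_sat[of \<psi> "M u"] models_iff_sat[of \<psi> "M w"]
      unfolding fin_structure_def FO_def by blast
  qed
  then show thesis using that uw by blast
qed

section \<open>Hereditarily finite sets in arithmetical structures\<close>

abbreviation "Marked \<equiv> Other 0 (Suc 0)"
abbreviation "Elem \<equiv> Other 0 (Suc (Suc 0))"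
abbreviation "Bit j \<equiv> Other (Suc j) (Suc (Suc 0))"

definition set_vocab :: "rel_sym set" where
  "set_vocab = {Lt, Add, Mul, Marked, Elem} \<union> Bit ` {..<3}"

lemma card_atoms_set_vocab_less: "card (atoms set_vocab q) < 2 ^ (3 * Suc q)"
proof -
  have "card (atoms set_vocab q) \<le> q\<^sup>2 + (\<Sum>R\<in>set_vocab. q ^ arity R)"
    by (rule card_atoms_le) (simp add: set_vocab_def)
  also have "\<dots> = 2 * q ^ 3 + 6 * q\<^sup>2 + q"
    by (simp add: set_vocab_def lessThan_nat_numeral lessThan_Suc eval_nat_numeral)
  also have "\<dots> < (2 * Suc q) ^ 3"
    by (simp add: power2_eq_square power3_eq_cube algebra_simps)
  also have "\<dots> \<le> (2 ^ Suc q) ^ 3"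
    using less_exp[of q] by (intro power_mono) (simp_all only: power_Suc Suc_le_eq mult_le_mono2)
  also have "\<dots> = 2 ^ (3 * Suc q)"
    by (simp only: mult.commute flip: power_mult)
  finally show ?thesis .
qed

text \<open>
  The element \<open>a\<close> of a structure stands for the set of height \<open>height q a\<close> with Ackermann code
  \<open>code q a\<close>. Elements of height 0 are urelements. The code of a set of height \<open>d\<close> has
  \<open>code_length q d\<close> bits, and \<open>set_structure q u\<close> describes the set of height \<open>q + 1\<close> with code \<open>u\<close>.
\<close>

definition code_length :: "nat \<Rightarrow> nat \<Rightarrow> nat" where
  "code_length q d = tower d (3 * Suc q)"

lemma code_length_0 [simp]: "code_length q 0 = 3 * Suc q"
  by (simp add: code_length_def)

lemma code_length_Suc [simp]: "code_length q (Suc d) = 2 ^ code_length q d"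
  by (simp add: code_length_def)

definition height :: "nat \<Rightarrow> nat \<Rightarrow> nat" where
  "height q a = a mod Suc q"

definition code :: "nat \<Rightarrow> nat \<Rightarrow> nat" where
  "code q a = a div Suc q"

lemma ex_height_code:
  assumes "d \<le> q"
  shows "\<exists>a. height q a = d \<and> code q a = t"
proof (intro exI conjI)
  show "height q (t * Suc q + d) = d" "code q (t * Suc q + d) = t"
    using assms by (simp_all add: height_def code_def del: mult_Suc_right)
qed

definition universe_size :: "nat \<Rightarrow> nat" where
  "universe_size q = code_length q (Suc q) * Suc q"

lemma less_universe_size_iff: "a < universe_size q \<longleftrightarrow> code q a < code_length q (Suc q)"
  unfolding universe_size_def code_def by (rule div_less_iff_less_mult[symmetric]) simp

fun set_interp :: "nat \<Rightarrow> nat \<Rightarrow> rel_sym \<Rightarrow> nat list set" where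
  "set_interp q u Marked =
     {[a] | a. a < universe_size q \<and> height q a = q \<and> code q a \<in> set_decode u}"
| "set_interp q u Elem =
     {[b, a] | b a. b < universe_size q \<and> a < universe_size q \<and>
        height q a = Suc (height q b) \<and> code q b \<in> set_decode (code q a)}"
| "set_interp q u (Bit j) =
     {[b, a] | b a. b < universe_size q \<and> a < universe_size q \<and>
        3 * height q a + j \<in> set_decode (code q b)}"
| "set_interp q u R = arith_interp (universe_size q) R"

definition set_structure :: "nat \<Rightarrow> nat \<Rightarrow> nat struct" where
  "set_structure q u = \<lparr>univ = {..<universe_size q}, interp = set_interp q u\<rparr>"

lemma univ_set_structure [simp]: "univ (set_structure q u) = {..<universe_size q}"
  by (simp add: set_structure_def)

lemma interp_set_structure [simp]: "interp (set_structure q u) = set_interp q u"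
  by (simp add: set_structure_def)

lemma set_structure_in_arith_structures: "set_structure q u \<in> arith_structures set_vocab"
proof -
  have "universe_size q > 0"
    by (simp add: universe_size_def)
  then have "fin_structure set_vocab (set_structure q u)"
    unfolding fin_structure_def by (auto simp: set_vocab_def)
  moreover have "built_in_arith (set_structure q u)"
    unfolding built_in_arith_def isomorphic_on_def
    by (intro exI[of _ id]) (auto simp: arith_structure_def arith_vocab_def)
  ultimately show ?thesis
    by (simp add: arith_structures_def)
qed

section \<open>Defining sets by their codes\<close>

primrec has_bits :: "nat \<Rightarrow> (nat \<Rightarrow> fm) \<Rightarrow> nat \<Rightarrow> fm" where
  "has_bits 0 \<psi> t = Neg Fls"
| "has_bits (Suc n) \<psi> t = Conj (has_bits n \<psi> t) (if n \<in> set_decode t then \<psi> n else Neg (\<psi> n))"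

lemma over_vocab_has_bits: "over_vocab \<tau> (has_bits n \<psi> t) \<longleftrightarrow> (\<forall>b<n. over_vocab \<tau> (\<psi> b))"
  by (induction n) (auto simp: less_Suc_eq)

lemma free_vars_has_bits: "free_vars (has_bits n \<psi> t) = (\<Union>b<n. free_vars (\<psi> b))"
  by (induction n) (auto simp: lessThan_Suc)

lemma quant_rank_has_bits_le: "quant_rank (has_bits n \<psi> t) \<le> r \<longleftrightarrow> (\<forall>b<n. quant_rank (\<psi> b) \<le> r)"
  by (induction n) (auto simp: less_Suc_eq)

lemma sat_has_bits:
  "sat M s (has_bits n \<psi> t) \<longleftrightarrow> (\<forall>b<n. sat M s (\<psi> b) \<longleftrightarrow> b \<in> set_decode t)"
  by (induction n) (auto simp: less_Suc_eq)

lemma sat_has_bits_iff_eq: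
  assumes "m < 2 ^ n" "t < 2 ^ n" "\<And>b. b < n \<Longrightarrow> sat M s (\<psi> b) \<longleftrightarrow> b \<in> set_decode m"
  shows "sat M s (has_bits n \<psi> t) \<longleftrightarrow> m = t"
  using assms by (simp add: sat_has_bits eq_iff_set_decode_lessThan)

text \<open>
  If the variables \<open>d, \<dots>, q\<close> hold elements of these heights, then \<open>has_code q d t\<close> says that
  the value of variable \<open>d\<close> has code \<open>t\<close>.
\<close>

primrec has_code :: "nat \<Rightarrow> nat \<Rightarrow> nat \<Rightarrow> fm" where
  "has_code q 0 t = has_bits (code_length q 0) (\<lambda>b. Rel (Bit (b mod 3)) [0, b div 3]) t"
| "has_code q (Suc d) t = has_bits (code_length q (Suc d))
     (\<lambda>b. Ex d (Conj (Rel Elem [d, Suc d]) (has_code q d b))) t"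

lemma over_vocab_has_code: "over_vocab set_vocab (has_code q d t)"
  by (induction d arbitrary: t) (auto simp: over_vocab_has_bits set_vocab_def)

lemma free_vars_has_code: "d \<le> q \<Longrightarrow> free_vars (has_code q d t) \<subseteq> {d..q}"
proof (induction d arbitrary: t)
  case 0
  show ?case by (auto simp: free_vars_has_bits)
next
  case (Suc d)
  have "free_vars (has_code q d b) \<subseteq> insert d {Suc d..q}" for b
    using Suc by (simp add: atLeastAtMost_insertL)
  then show ?case
    unfolding has_code.simps free_vars_has_bits by (intro UN_least) (use Suc.prems in force)
qed

lemma quant_rank_has_code_le: "quant_rank (has_code q d t) \<le> d"
proof (induction d arbitrary: t)
  case 0
  show ?case unfolding has_code.simps quant_rank_has_bits_le by simp
next
  case (Suc d)
  then show ?case unfolding has_code.simps quant_rank_has_bits_le by simp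
qed

definition respects_heights :: "nat \<Rightarrow> nat \<Rightarrow> (nat \<Rightarrow> nat) \<Rightarrow> bool" where
  "respects_heights q d s \<longleftrightarrow> (\<forall>i\<in>{d..q}. s i < universe_size q \<and> height q (s i) = i)"

lemma respects_heights_upd:
  assumes "respects_heights q (Suc d) s" "a < universe_size q" "height q a = d"
  shows "respects_heights q d (s(d := a))"
  using assms by (auto simp: respects_heights_def)

lemma sat_Ex_code_iff:
  assumes "d \<le> q" "D \<subseteq> {..<code_length q (Suc d)}"
    and "\<And>a. a < universe_size q \<Longrightarrow>
      sat (set_structure q u) (s(d := a)) \<rho> \<longleftrightarrow> height q a = d \<and> code q a \<in> D"
    and "\<And>a. a < universe_size q \<Longrightarrow> height q a = d \<Longrightarrow> code q a \<in> D \<Longrightarrow>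
      sat (set_structure q u) (s(d := a)) \<chi> \<longleftrightarrow> code q a = t"
  shows "sat (set_structure q u) s (Ex d (Conj \<rho> \<chi>)) \<longleftrightarrow> t \<in> D"
proof
  assume "sat (set_structure q u) s (Ex d (Conj \<rho> \<chi>))"
  then show "t \<in> D" using assms(3,4) by auto
next
  assume "t \<in> D"
  obtain a where a: "height q a = d" "code q a = t"
    using ex_height_code[OF assms(1)] by blast
  then have "code q a < code_length q (Suc d)"
    using assms(2) \<open>t \<in> D\<close> by blast
  also have "\<dots> \<le> code_length q (Suc q)"
    unfolding code_length_def using assms(1) by (intro monoD[OF mono_tower_height]) simp
  finally have "a < universe_size q"
    unfolding less_universe_size_iff .
  then show "sat (set_structure q u) s (Ex d (Conj \<rho> \<chi>))"
    using assms(3,4)[of a] a \<open>t \<in> D\<close> by auto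
qed

lemma sat_Bit_iff:
  assumes "respects_heights q 0 s" "b < code_length q 0"
  shows "sat (set_structure q u) s (Rel (Bit (b mod 3)) [0, b div 3]) \<longleftrightarrow>
    b \<in> set_decode (code q (s 0))"
proof -
  have "b div 3 \<le> q" using assms(2) by simp
  then have "s 0 < universe_size q" "s (b div 3) < universe_size q"
    and "height q (s (b div 3)) = b div 3"
    using assms(1) by (auto simp: respects_heights_def)
  then show ?thesis by simp
qed

lemma sat_Elem_iff:
  assumes "respects_heights q (Suc d) s" "d < q" "a < universe_size q"
  shows "sat (set_structure q u) (s(d := a)) (Rel Elem [d, Suc d]) \<longleftrightarrow>
    height q a = d \<and> code q a \<in> set_decode (code q (s (Suc d)))"
  using assms by (auto simp: respects_heights_def)

lemma sat_has_code_iff: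
  assumes "d \<le> q" "respects_heights q d s"
    and "code q (s d) < code_length q (Suc d)" "t < code_length q (Suc d)"
  shows "sat (set_structure q u) s (has_code q d t) \<longleftrightarrow> code q (s d) = t"
  using assms
proof (induction d arbitrary: s t)
  case 0
  show ?case
    unfolding has_code.simps by (rule sat_has_bits_iff_eq) (use "0.prems" sat_Bit_iff in auto)
next
  case (Suc d)
  let ?D = "set_decode (code q (s (Suc d)))"
  have D_subset: "?D \<subseteq> {..<code_length q (Suc d)}"
    using Suc.prems(3) by (simp add: less_two_power_iff_set_decode)
  have "sat (set_structure q u) s (Ex d (Conj (Rel Elem [d, Suc d]) (has_code q d b))) \<longleftrightarrow> b \<in> ?D"
    if b: "b < code_length q (Suc d)" for b
  proof (rule sat_Ex_code_iff[OF _ D_subset])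
    fix a assume a: "a < universe_size q"
    show "sat (set_structure q u) (s(d := a)) (Rel Elem [d, Suc d]) \<longleftrightarrow>
        height q a = d \<and> code q a \<in> ?D"
      using sat_Elem_iff[OF Suc.prems(2) _ a] Suc.prems(1) by simp
    assume "height q a = d" "code q a \<in> ?D"
    with a have "respects_heights q d (s(d := a))" "code q a < code_length q (Suc d)"
      using respects_heights_upd[OF Suc.prems(2)] D_subset by blast+
    then show "sat (set_structure q u) (s(d := a)) (has_code q d b) \<longleftrightarrow> code q a = b"
      using Suc.IH[of "s(d := a)" b, unfolded fun_upd_same] Suc_leD[OF Suc.prems(1)] b by blast
  qed (use Suc.prems(1) in simp)
  then show ?case
    using Suc.prems(3,4) unfolding has_code.simps by (intro sat_has_bits_iff_eq) simp_all
qed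

definition ex_marked :: "nat \<Rightarrow> nat \<Rightarrow> fm" where
  "ex_marked q t = Ex q (Conj (Rel Marked [q]) (has_code q q t))"

lemma ex_marked_in_FO: "ex_marked q t \<in> FO set_vocab (q + 1)"
  using over_vocab_has_code[of q q t] free_vars_has_code[of q q t] quant_rank_has_code_le[of q q t]
  by (auto simp: FO_def ex_marked_def set_vocab_def)

lemma sat_ex_marked_iff:
  assumes "u < code_length q (Suc (Suc q))" "t < code_length q (Suc q)"
  shows "sat (set_structure q u) s (ex_marked q t) \<longleftrightarrow> t \<in> set_decode u"
  unfolding ex_marked_def
proof (rule sat_Ex_code_iff)
  show "set_decode u \<subseteq> {..<code_length q (Suc q)}"
    using assms(1) by (simp add: less_two_power_iff_set_decode)
  fix a assume a: "a < universe_size q"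
  then show "sat (set_structure q u) (s(q := a)) (Rel Marked [q]) \<longleftrightarrow>
      height q a = q \<and> code q a \<in> set_decode u"
    by simp
  assume "height q a = q"
  with a have "respects_heights q q (s(q := a))" "code q a < code_length q (Suc q)"
    by (simp_all add: respects_heights_def less_universe_size_iff)
  then show "sat (set_structure q u) (s(q := a)) (has_code q q t) \<longleftrightarrow> code q a = t"
    using sat_has_code_iff[of q q "s(q := a)" t u] assms(2) by simp
qed simp

lemma models_ex_marked_iff:
  assumes "u < code_length q (Suc (Suc q))" "t < code_length q (Suc q)"
  shows "models (set_structure q u) (ex_marked q t) \<longleftrightarrow> t \<in> set_decode u"
proof -
  have "free_vars (ex_marked q t) = {}" "univ (set_structure q u) \<noteq> {}"
    using ex_marked_in_FO set_structure_in_arith_structures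
    by (auto simp: FO_def arith_structures_def fin_structure_def)
  then show ?thesis
    using sat_ex_marked_iff[OF assms] models_iff_sat by blast
qed

lemma tower_card_atoms_less_code_length:
  "tower (Suc q) (card (atoms set_vocab q)) < code_length q (Suc (Suc q))"
proof -
  have "tower (Suc q) (card (atoms set_vocab q)) < tower (Suc q) (2 ^ (3 * Suc q))"
    using strict_monoD[OF strict_mono_tower card_atoms_set_vocab_less] .
  then show ?thesis
    unfolding code_length_def tower_Suc_right[of "Suc q"] .
qed

theorem theorem6p1:
  shows "\<exists>\<tau>. finite \<tau> \<and> arith_vocab \<subseteq> \<tau> \<and>
    (\<forall>q::nat. \<exists>\<phi>\<in>FO \<tau> (q + 1). \<forall>\<psi>\<in>FO \<tau> q.
       \<not> equivalent_on (arith_structures \<tau> :: nat struct set) \<phi> \<psi>)"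
proof (intro exI[of _ set_vocab] conjI allI)
  show fin: "finite set_vocab" and "arith_vocab \<subseteq> set_vocab"
    by (auto simp: set_vocab_def arith_vocab_def)
  fix q :: nat
  obtain u w where code_bounds: "u < code_length q (Suc (Suc q))" "w < code_length q (Suc (Suc q))"
    and "u \<noteq> w"
    and agree: "\<And>\<psi>. \<psi> \<in> FO set_vocab q \<Longrightarrow>
      models (set_structure q u) \<psi> \<longleftrightarrow> models (set_structure q w) \<psi>"
    using FO_indistinguishableE[of set_vocab "{..<code_length q (Suc (Suc q))}" "set_structure q" q]
      fin set_structure_in_arith_structures tower_card_atoms_less_code_length
    by (auto simp: arith_structures_def)
  obtain t where "t < code_length q (Suc q)" "t \<in> set_decode u \<longleftrightarrow> t \<notin> set_decode w"
    using eq_iff_set_decode_lessThan[of u "code_length q (Suc q)" w] code_bounds \<open>u \<noteq> w\<close> by auto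
  then have "models (set_structure q u) (ex_marked q t) \<noteq>
      models (set_structure q w) (ex_marked q t)"
    using models_ex_marked_iff code_bounds by simp
  then have "\<not> equivalent_on (arith_structures set_vocab :: nat struct set) (ex_marked q t) \<psi>"
    if "\<psi> \<in> FO set_vocab q" for \<psi>
    using agree[OF that] set_structure_in_arith_structures unfolding equivalent_on_def by blast
  then show "\<exists>\<phi>\<in>FO set_vocab (q + 1). \<forall>\<psi>\<in>FO set_vocab q.
      \<not> equivalent_on (arith_structures set_vocab :: nat struct set) \<phi> \<psi>"
    using ex_marked_in_FO by blast
qed

end
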